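(* $\Gamma\subset MAX$, where the inclusion is strict.
   Context: $\mathbb{N}$ is the set of positive integers and $\beta\mathbb{N}$ the set of all ultrafilters on $\mathbb{N}$, with the topology generated by the sets $\overline{A}=\{\mathcal{F}\in\beta\mathbb{N}:A\in\mathcal{F}\}$, $A\subseteq\mathbb{N}$. For $A\subseteq\mathbb{N}$ and $n\in\mathbb{N}$, $A-n=\{a-n:a\in A,\ a>n\}$, and $\mathcal{F}+\mathcal{G}=\{A\subseteq\mathbb{N}:\{n\in\mathbb{N}:A-n\in\mathcal{G}\}\in\mathcal{F}\}$ for $\mathcal{F},\mathcal{G}\in\beta\mathbb{N}$. $\Gamma$ is the topological closure in $\beta\mathbb{N}$ of the set of $+$-idempotents $\{\mathcal{F}\in\beta\mathbb{N}:\mathcal{F}+\mathcal{F}=\mathcal{F}\}$. For $A\subseteq\mathbb{N}$, $A\!\uparrow\;=\{n\in\mathbb{N}:(\exists a\in A)\ a\mid n\}$, and $\mathcal{F}\,\widetilde{\mid}\,\mathcal{G}$ means that $A\!\uparrow\;\in\mathcal{G}$ for every $A\in\mathcal{F}$. $MAX$ is the $\widetilde{\mid}$-greatest class, i.e. the set of all $\mathcal{G}\in\beta\mathbb{N}$ such that $\mathcal{F}\,\widetilde{\mid}\,\mathcal{G}$ for all $\mathcal{F}\in\beta\mathbb{N}$; equivalently, the set of all $\mathcal{G}\in\beta\mathbb{N}$ containing every nonempty $A\subseteq\mathbb{N}$ with $A=A\!\uparrow$. *)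

theory Defs
  imports "HOL-Analysis.Analysis"
begin

text \<open>
  The set of positive integers is the carrier set \<open>\<nat>\<^sub>+\<close> inside type \<^typ>\<open>nat\<close>, and an ultrafilter on it
  is the set of its members, all of which are subsets of the carrier.
\<close>

definition posnat :: "nat set" (\<open>\<nat>\<^sub>+\<close>)
  where "\<nat>\<^sub>+ = {n. 0 < n}"

definition ultrafilter_on :: "'a set \<Rightarrow> 'a set set \<Rightarrow> bool"
  where "ultrafilter_on X F \<longleftrightarrow>
    F \<subseteq> Pow X \<and> X \<in> F \<and> {} \<notin> F \<and>
    (\<forall>A\<in>F. \<forall>B\<in>F. A \<inter> B \<in> F) \<and>
    (\<forall>A B. A \<in> F \<and> A \<subseteq> B \<and> B \<subseteq> X \<longrightarrow> B \<in> F) \<and>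
    (\<forall>A. A \<subseteq> X \<longrightarrow> A \<in> F \<or> X - A \<in> F)"

definition betaN :: "nat set set set"
  where "betaN = {F. ultrafilter_on \<nat>\<^sub>+ F}"

definition basic_open :: "nat set \<Rightarrow> nat set set set"
  where "basic_open A = {F \<in> betaN. A \<in> F}"

definition betaN_topology :: "nat set set topology"
  where "betaN_topology = topology_generated_by (basic_open ` Pow \<nat>\<^sub>+)"

definition set_shift :: "nat set \<Rightarrow> nat \<Rightarrow> nat set"
  where "set_shift A n = {a - n | a. a \<in> A \<and> n < a}"

definition ultra_add :: "nat set set \<Rightarrow> nat set set \<Rightarrow> nat set set"  (infixl \<open>\<oplus>\<^sub>\<beta>\<close> 65)
  where "F \<oplus>\<^sub>\<beta> G = {A. A \<subseteq> \<nat>\<^sub>+ \<and> {n \<in> \<nat>\<^sub>+. set_shift A n \<in> G} \<in> F}"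

definition add_idempotents :: "nat set set set"
  where "add_idempotents = {F \<in> betaN. F \<oplus>\<^sub>\<beta> F = F}"

definition Gamma_set :: "nat set set set"
  where "Gamma_set = betaN_topology closure_of add_idempotents"

definition up_closure :: "nat set \<Rightarrow> nat set"
  where "up_closure A = {n \<in> \<nat>\<^sub>+. \<exists>a\<in>A. a dvd n}"

definition ultra_dvd :: "nat set set \<Rightarrow> nat set set \<Rightarrow> bool"  (infix \<open>dvd\<^sub>\<beta>\<close> 50)
  where "F dvd\<^sub>\<beta> G \<longleftrightarrow> (\<forall>A\<in>F. up_closure A \<in> G)"

definition MAX_class :: "nat set set set"
  where "MAX_class = {G \<in> betaN. \<forall>F\<in>betaN. F dvd\<^sub>\<beta> G}"

end

theory Submission
  imports Defs
begin

text \<open>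
  Both halves rest on one observation: every member \<open>A\<close> of an additive idempotent contains
  \<open>x\<close>, \<open>y\<close> and \<open>x + y\<close> for suitable \<open>x\<close>, \<open>y\<close> (\<open>idempotent_member_contains_sum\<close>). Since basic
  open sets are neighbourhoods, every member of an ultrafilter in the closure \<open>\<Gamma>\<close> is also a member of
  some idempotent (\<open>Gamma_member_in_idempotent\<close>), so it has the same property.

  Inclusion. An ultrafilter lies in \<open>MAX\<close> as soon as it contains the set of multiples of every
  positive \<open>n\<close>, because every nonempty up-closed set includes such a set. An idempotent contains
  exactly one residue class modulo \<open>n\<close>; as this class contains \<open>x\<close>, \<open>y\<close> and \<open>x + y\<close>, it
  is the class of \<open>0\<close>. Divisibility by \<open>n\<close> passes to the closure, for otherwise the set of
  non-multiples would belong to some idempotent.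

  Strictness. The set of factorials \<open>k!\<close> with \<open>k \<ge> 2\<close> grows too fast to contain \<open>x\<close>, \<open>y\<close>
  and \<open>x + y\<close>, so no ultrafilter containing it is in \<open>\<Gamma>\<close>. Its tails have the finite intersection
  property, and the tail from \<open>n\<close> on consists of multiples of \<open>n\<close>. An ultrafilter containing all
  the tails is therefore in \<open>MAX\<close> but not in \<open>\<Gamma>\<close>.
\<close>

section \<open>Ultrafilters on a set\<close>

lemma ultrafilter_onD:
  assumes "ultrafilter_on X F"
  shows "A \<in> F \<Longrightarrow> A \<subseteq> X" "X \<in> F" "{} \<notin> F"
    "A \<in> F \<Longrightarrow> B \<in> F \<Longrightarrow> A \<inter> B \<in> F"
    "A \<in> F \<Longrightarrow> A \<subseteq> B \<Longrightarrow> B \<subseteq> X \<Longrightarrow> B \<in> F"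
    "A \<subseteq> X \<Longrightarrow> A \<notin> F \<Longrightarrow> X - A \<in> F"
proof -
  note F = assms[unfolded ultrafilter_on_def]
  show "A \<in> F \<Longrightarrow> A \<subseteq> X" "X \<in> F" "{} \<notin> F"
    using F by auto
  show "A \<in> F \<Longrightarrow> B \<in> F \<Longrightarrow> A \<inter> B \<in> F"
    using F by simp
  show "A \<in> F \<Longrightarrow> A \<subseteq> B \<Longrightarrow> B \<subseteq> X \<Longrightarrow> B \<in> F"
    using F by metis
  show "A \<subseteq> X \<Longrightarrow> A \<notin> F \<Longrightarrow> X - A \<in> F"
    using F by metis
qed

lemma ultrafilter_on_finite_Union:
  assumes F: "ultrafilter_on X F" and "finite I" "(\<Union>i\<in>I. A i) \<in> F"
  shows "\<exists>i\<in>I. A i \<in> F"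
  using assms(2,3)
proof (induction I)
  case empty
  then show ?case using ultrafilter_onD(3)[OF F] by simp
next
  case (insert i I)
  show ?case
  proof (cases "A i \<in> F")
    case False
    have sub: "(\<Union>j\<in>insert i I. A j) \<subseteq> X"
      using insert.prems ultrafilter_onD(1)[OF F] by blast
    then have "X - A i \<in> F"
      using False ultrafilter_onD(6)[OF F] by simp
    then have "(\<Union>j\<in>insert i I. A j) \<inter> (X - A i) \<in> F"
      using insert.prems ultrafilter_onD(4)[OF F] by blast
    then have "(\<Union>j\<in>I. A j) \<in> F"
      by (rule ultrafilter_onD(5)[OF F]) (use sub in auto)
    then show ?thesis using insert.IH by simp
  qed simp
qed

text \<open>
  By Zorn's lemma the family extends to a maximal one with the finite intersection property.
  Maximality says that a set meeting all finite intersections of the family is in it, and every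
  ultrafilter axiom follows from that.
\<close>

lemma ultrafilter_on_extending_fip:
  assumes "B \<subseteq> Pow X" and "\<And>S. finite S \<Longrightarrow> S \<subseteq> B \<Longrightarrow> X \<inter> \<Inter>S \<noteq> {}"
  shows "\<exists>F. ultrafilter_on X F \<and> B \<subseteq> F"
proof -
  define fip where "fip C \<longleftrightarrow> (\<forall>S. finite S \<and> S \<subseteq> C \<longrightarrow> X \<inter> \<Inter>S \<noteq> {})" for C
  define \<C> where "\<C> = {C. B \<subseteq> C \<and> C \<subseteq> Pow X \<and> fip C}"
  have "\<exists>M\<in>\<C>. \<forall>C\<in>\<C>. M \<subseteq> C \<longrightarrow> C = M"
  proof (rule subset_Zorn_nonempty)
    have "fip B"
      unfolding fip_def by (intro allI impI assms(2)) simp_all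
    then have "B \<in> \<C>"
      using assms(1) by (simp add: \<C>_def)
    then show "\<C> \<noteq> {}" by blast
  next
    fix K assume K: "K \<noteq> {}" "subset.chain \<C> K"
    have "K \<subseteq> \<C>"
      using K(2) by (simp add: subset.chain_def)
    have "fip (\<Union>K)"
      unfolding fip_def
    proof (intro allI impI)
      fix S assume "finite S \<and> S \<subseteq> \<Union>K"
      then obtain C where "C \<in> K" "finite S" "S \<subseteq> C"
        using finite_subset_Union_chain[of S K \<C>] K by metis
      moreover from this have "fip C"
        using \<open>K \<subseteq> \<C>\<close> by (auto simp: \<C>_def)
      ultimately show "X \<inter> \<Inter>S \<noteq> {}"
        by (simp add: fip_def)
    qed
    then show "\<Union>K \<in> \<C>"
      using K(1) \<open>K \<subseteq> \<C>\<close> by (fastforce simp: \<C>_def)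
  qed
  then obtain M where M: "B \<subseteq> M" "M \<subseteq> Pow X" "fip M"
    and max: "\<And>C. C \<in> \<C> \<Longrightarrow> M \<subseteq> C \<Longrightarrow> C = M"
    by (auto simp: \<C>_def)
  have memI: "A \<in> M"
    if "A \<subseteq> X" and meets: "\<And>S. finite S \<Longrightarrow> S \<subseteq> M \<Longrightarrow> A \<inter> \<Inter>S \<noteq> {}" for A
  proof -
    have "fip (insert A M)"
      unfolding fip_def
    proof (intro allI impI)
      fix S assume S: "finite S \<and> S \<subseteq> insert A M"
      then have "A \<inter> \<Inter>(S - {A}) \<noteq> {}"
        by (intro meets) auto
      then show "X \<inter> \<Inter>S \<noteq> {}"
        using \<open>A \<subseteq> X\<close> by blast
    qed
    then have "insert A M = M"
      using M \<open>A \<subseteq> X\<close> by (intro max) (auto simp: \<C>_def)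
    then show ?thesis by blast
  qed
  have meet: "X \<inter> \<Inter>S \<noteq> {}" if "finite S" "S \<subseteq> M" for S
    using M(3) that by (simp add: fip_def)
  have "ultrafilter_on X M"
    unfolding ultrafilter_on_def
  proof (intro conjI ballI allI impI)
    show "M \<subseteq> Pow X" by (fact M(2))
    show "X \<in> M" by (rule memI) (simp_all add: meet)
    show "{} \<notin> M" using meet[of "{{}}"] by auto
  next
    fix C D assume CD: "C \<in> M" "D \<in> M"
    show "C \<inter> D \<in> M"
    proof (rule memI)
      fix S assume "finite S" "S \<subseteq> M"
      then show "C \<inter> D \<inter> \<Inter>S \<noteq> {}"
        using meet[of "insert C (insert D S)"] CD by auto
    qed (use CD M(2) in blast)
  next
    fix C D assume CD: "C \<in> M \<and> C \<subseteq> D \<and> D \<subseteq> X"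
    show "D \<in> M"
    proof (rule memI)
      fix S assume "finite S" "S \<subseteq> M"
      then show "D \<inter> \<Inter>S \<noteq> {}"
        using meet[of "insert C S"] CD by auto
    qed (use CD in blast)
  next
    fix C assume "C \<subseteq> X"
    show "C \<in> M \<or> X - C \<in> M"
    proof (rule ccontr)
      assume neg: "\<not> (C \<in> M \<or> X - C \<in> M)"
      obtain S where S: "finite S" "S \<subseteq> M" "C \<inter> \<Inter>S = {}"
        using neg memI[of C] \<open>C \<subseteq> X\<close> by blast
      obtain T where T: "finite T" "T \<subseteq> M" "(X - C) \<inter> \<Inter>T = {}"
        using neg memI[of "X - C"] by blast
      have "X \<inter> \<Inter>(S \<union> T) = {}"
        using S(3) T(3) by blast
      then show False
        using meet[of "S \<union> T"] S T by blast
    qed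
  qed
  then show ?thesis using M(1) by blast
qed

section \<open>Members of idempotents\<close>

text \<open>
  Unfolding \<open>A \<in> E \<oplus>\<^sub>\<beta> E\<close> gives an \<open>x \<in> A\<close> with \<open>A - x \<in> E\<close>; then any
  \<open>y\<close> in \<open>A \<inter> (A - x)\<close> will do.
\<close>

lemma idempotent_member_contains_sum:
  assumes "E \<in> add_idempotents" "A \<in> E"
  shows "\<exists>x\<in>A. \<exists>y\<in>A. x + y \<in> A"
proof -
  have E: "ultrafilter_on \<nat>\<^sub>+ E" and idem: "E \<oplus>\<^sub>\<beta> E = E"
    using assms(1) by (auto simp: add_idempotents_def betaN_def)
  have inter_nonempty: "C \<inter> D \<noteq> {}" if "C \<in> E" "D \<in> E" for C D
    using ultrafilter_onD(3,4)[OF E] that by metis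
  have "A \<in> E \<oplus>\<^sub>\<beta> E"
    using idem assms(2) by simp
  then have "{n \<in> \<nat>\<^sub>+. set_shift A n \<in> E} \<in> E"
    by (simp add: ultra_add_def)
  then obtain x where x: "x \<in> A" "set_shift A x \<in> E"
    using inter_nonempty[OF assms(2)] by blast
  then obtain y where "y \<in> A" "y \<in> set_shift A x"
    using inter_nonempty[OF assms(2)] by blast
  then have "x + y \<in> A"
    by (auto simp: set_shift_def)
  then show ?thesis using x(1) \<open>y \<in> A\<close> by blast
qed

lemma idempotent_contains_multiples:
  assumes "E \<in> add_idempotents" "0 < n"
  shows "{m \<in> \<nat>\<^sub>+. n dvd m} \<in> E"
proof -
  have E: "ultrafilter_on \<nat>\<^sub>+ E"
    using assms(1) by (auto simp: add_idempotents_def betaN_def)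
  have "(\<Union>r<n. {m \<in> \<nat>\<^sub>+. m mod n = r}) = \<nat>\<^sub>+"
    using assms(2) by auto
  then obtain r where "{m \<in> \<nat>\<^sub>+. m mod n = r} \<in> E"
    using ultrafilter_on_finite_Union[OF E, of "{..<n}" "\<lambda>r. {m \<in> \<nat>\<^sub>+. m mod n = r}"]
      ultrafilter_onD(2)[OF E] by auto
  moreover from this obtain x y where
    "x mod n = r" "y mod n = r" "(x + y) mod n = r"
    using idempotent_member_contains_sum[OF assms(1)] by blast
  \<comment> \<open>\<open>x + y\<close> and \<open>x\<close> are in the same class, so their difference \<open>y\<close> is in the class of \<open>0\<close>.\<close>
  then have "n dvd (x + y) - x"
    by (metis mod_eq_dvd_iff_nat le_add1)
  then have "r = 0"
    using \<open>y mod n = r\<close> by (simp add: dvd_eq_mod_eq_0)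
  ultimately show ?thesis
    by (simp add: dvd_eq_mod_eq_0)
qed

section \<open>The closure of the idempotents\<close>

lemma topspace_betaN_topology: "topspace betaN_topology = betaN"
  by (auto simp: betaN_topology_def basic_open_def betaN_def ultrafilter_on_def)

lemma Gamma_subset_betaN: "Gamma_set \<subseteq> betaN"
  using closure_of_subset_topspace[of betaN_topology]
  by (simp add: Gamma_set_def topspace_betaN_topology)

lemma Gamma_member_in_idempotent:
  assumes "G \<in> Gamma_set" "A \<in> G"
  shows "\<exists>E\<in>add_idempotents. A \<in> E"
proof -
  have "G \<in> betaN"
    using assms(1) Gamma_subset_betaN by blast
  then have "A \<subseteq> \<nat>\<^sub>+"
    using assms(2) ultrafilter_onD(1) by (auto simp: betaN_def)
  then have "openin betaN_topology (basic_open A)"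
    unfolding betaN_topology_def by (intro topology_generated_by_Basis) blast
  moreover have "G \<in> basic_open A"
    using \<open>G \<in> betaN\<close> assms(2) by (simp add: basic_open_def)
  ultimately obtain E where "E \<in> add_idempotents" "E \<in> basic_open A"
    using assms(1) unfolding Gamma_set_def in_closure_of by blast
  then show ?thesis by (auto simp: basic_open_def)
qed

lemma MAX_classI:
  assumes G: "G \<in> betaN" and multiples: "\<And>n. 0 < n \<Longrightarrow> {m \<in> \<nat>\<^sub>+. n dvd m} \<in> G"
  shows "G \<in> MAX_class"
proof -
  have "up_closure A \<in> G" if "F \<in> betaN" and A: "A \<in> F" for F A
  proof -
    have F: "ultrafilter_on \<nat>\<^sub>+ F"
      using \<open>F \<in> betaN\<close> by (simp add: betaN_def)
    have "A \<noteq> {}"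
      using A ultrafilter_onD(3)[OF F] by blast
    then obtain a where a: "a \<in> A" "0 < a"
      using ultrafilter_onD(1)[OF F A] by (auto simp: posnat_def)
    have "{m \<in> \<nat>\<^sub>+. a dvd m} \<subseteq> up_closure A" "up_closure A \<subseteq> \<nat>\<^sub>+"
      using a(1) by (auto simp: up_closure_def)
    then show ?thesis
      using G multiples[OF a(2)] ultrafilter_onD(5) by (auto simp: betaN_def)
  qed
  then show ?thesis
    using G by (simp add: MAX_class_def ultra_dvd_def)
qed

text \<open>
  If the multiples of \<open>n\<close> were not in \<open>G\<close>, their complement would be, and hence would be in some
  idempotent, which contains the multiples as well.
\<close>

lemma Gamma_subset_MAX: "Gamma_set \<subseteq> MAX_class"
proof
  fix G assume G: "G \<in> Gamma_set"
  then have "G \<in> betaN"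
    using Gamma_subset_betaN by blast
  then show "G \<in> MAX_class"
  proof (rule MAX_classI)
    fix n :: nat assume "0 < n"
    show "{m \<in> \<nat>\<^sub>+. n dvd m} \<in> G" (is "?M \<in> G")
    proof (rule ccontr)
      assume "?M \<notin> G"
      then have "\<nat>\<^sub>+ - ?M \<in> G"
        using \<open>G \<in> betaN\<close> ultrafilter_onD(6)[of "\<nat>\<^sub>+" G ?M] by (auto simp: betaN_def)
      then obtain E where E: "E \<in> add_idempotents" "\<nat>\<^sub>+ - ?M \<in> E"
        using Gamma_member_in_idempotent[OF G] by blast
      then have "ultrafilter_on \<nat>\<^sub>+ E"
        by (auto simp: add_idempotents_def betaN_def)
      then have "(\<nat>\<^sub>+ - ?M) \<inter> ?M \<in> E"
        using E idempotent_contains_multiples[OF E(1) \<open>0 < n\<close>] ultrafilter_onD(4) by blast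
      moreover have "(\<nat>\<^sub>+ - ?M) \<inter> ?M = {}"
        by blast
      ultimately show False
        using \<open>ultrafilter_on \<nat>\<^sub>+ E\<close> ultrafilter_onD(3) by metis
    qed
  qed
qed

section \<open>Factorials\<close>

text \<open>
  If \<open>i \<ge> j \<ge> 2\<close>, then \<open>i!\<close> is less than the sum and the next factorial \<open>(i + 1)! \<ge> 3 \<cdot> i!\<close> exceeds
  it. The bound \<open>2\<close> is sharp, as \<open>1! + 1! = 2!\<close>.
\<close>

lemma fact_add_fact_neq_fact:
  fixes i j k :: nat
  assumes "2 \<le> i" "2 \<le> j"
  shows "(fact i + fact j :: nat) \<noteq> fact k"
proof -
  have neq: "(fact i + fact j :: nat) \<noteq> fact k" if "2 \<le> j" "j \<le> i" for i j :: nat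
  proof (cases "k \<le> i")
    case True
    then have "fact k \<le> (fact i :: nat)"
      by (rule fact_mono)
    then show ?thesis
      using fact_gt_zero[of j, where ?'a = nat] by linarith
  next
    case False
    have le: "fact j \<le> (fact i :: nat)"
      using that(2) by (rule fact_mono)
    have "3 * fact i \<le> Suc i * (fact i :: nat)"
      using that by (intro mult_right_mono) auto
    also have "\<dots> = fact (Suc i)"
      by simp
    also have "\<dots> \<le> (fact k :: nat)"
      using False by (intro fact_mono) simp
    finally show ?thesis
      using le fact_gt_zero[of i, where ?'a = nat] by linarith
  qed
  show ?thesis
    using neq[of j i] neq[of i j] assms by (cases "j \<le> i") (simp_all add: add.commute)
qed

definition factorial_tail :: "nat \<Rightarrow> nat set"
  where "factorial_tail n = {fact k | k. 2 \<le> k \<and> n \<le> k}"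

lemma ultrafilter_containing_factorial_tails:
  "\<exists>G\<in>betaN. \<forall>n. factorial_tail n \<in> G"
proof -
  have "\<exists>G. ultrafilter_on \<nat>\<^sub>+ G \<and> range factorial_tail \<subseteq> G"
  proof (rule ultrafilter_on_extending_fip)
    show "range factorial_tail \<subseteq> Pow \<nat>\<^sub>+"
      by (auto simp: factorial_tail_def posnat_def)
  next
    fix S assume "finite S" "S \<subseteq> range factorial_tail"
    then obtain I where I: "finite I" "S = factorial_tail ` I"
      using finite_subset_image by metis
    \<comment> \<open>The \<open>2\<close> makes the maximum defined for empty \<open>I\<close> and keeps it in the index range of every tail.\<close>
    have "fact (Max (insert 2 I)) \<in> \<nat>\<^sub>+ \<inter> \<Inter>S"
      using I by (auto simp: factorial_tail_def posnat_def simp del: Max_insert)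
    then show "\<nat>\<^sub>+ \<inter> \<Inter>S \<noteq> {}"
      by blast
  qed
  then show ?thesis
    by (auto simp: betaN_def)
qed

theorem theorem4p7:
  shows "Gamma_set \<subset> MAX_class"
proof -
  obtain G where G: "G \<in> betaN" "\<And>n. factorial_tail n \<in> G"
    using ultrafilter_containing_factorial_tails by blast
  have "G \<in> MAX_class"
  proof (rule MAX_classI[OF G(1)])
    fix n :: nat assume "0 < n"
    then have "factorial_tail n \<subseteq> {m \<in> \<nat>\<^sub>+. n dvd m}"
      by (auto simp: factorial_tail_def posnat_def intro: dvd_fact)
    then show "{m \<in> \<nat>\<^sub>+. n dvd m} \<in> G"
      using G ultrafilter_onD(5)[of "\<nat>\<^sub>+" G "factorial_tail n"] by (auto simp: betaN_def)
  qed
  moreover have "G \<notin> Gamma_set"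
  proof
    assume "G \<in> Gamma_set"
    then obtain E where "E \<in> add_idempotents" "factorial_tail 2 \<in> E"
      using Gamma_member_in_idempotent G(2) by blast
    then obtain x y where xy: "x \<in> factorial_tail 2" "y \<in> factorial_tail 2"
        "x + y \<in> factorial_tail 2"
      using idempotent_member_contains_sum by blast
    then obtain i j k where "2 \<le> i" "2 \<le> j" "x = fact i" "y = fact j" "x + y = fact k"
      by (auto simp: factorial_tail_def)
    then show False
      using fact_add_fact_neq_fact by metis
  qed
  ultimately show ?thesis
    using Gamma_subset_MAX by blast
qed

end
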